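(* Let $g > 1$ be an even integer, and let $k > 0$ be an integer. Let $r = k \bmod (g-1)$ (the remainder, $0\le r<g-1$). Define integers $q$, $A$, and $B$ by $$q = \begin{cases} \left\lfloor\frac{k}{g-1}\right\rfloor - 1 & \text{if } r = 0,\\ \left\lfloor\frac{k}{g-1}\right\rfloor & \text{otherwise;}\end{cases}$$ $$A = \begin{cases} \frac{g}{2} & \text{if } r = 0 \text{ or } r > \frac{g}{2},\\ r & \text{otherwise;}\end{cases}\qquad B = \begin{cases} \frac{g}{2} - 1 & \text{if } r = 0,\\ r - \frac{g}{2} & \text{if } r > \frac{g}{2},\\ 0 & \text{otherwise.}\end{cases}$$ Then $$\lambda_g(k) = \frac{g(1 - g^{2q})}{2(1+g)} + A g^{2q} + B g^{2q+1}.$$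
   Context: For a group $G$ with generating set $S$, the Cayley graph $\Gamma(G,S)$ has vertex set $G$, with $x$ and $y$ joined by an edge whenever $xs=y$ for some $s\in S$; it carries the shortest-path metric in which every edge has length $1$. For an integer $g\ge 2$, let $S_g=\{\pm g^i : i\in\mathbb{Z}_{\ge 0}\}$ and let $C_g=\Gamma(\mathbb{Z},S_g)$ be the Cayley graph of the additive group $\mathbb{Z}$. The $g$-length $\ell_g(n)$ of an integer $n$ is the distance from $0$ to $n$ in $C_g$, i.e. the least number of terms in an expression of $n$ as a sum of elements of $S_g$ (repetitions allowed; $\ell_g(0)=0$). For a positive integer $h$, $\lambda_g(h)$ denotes the smallest positive integer $n$ (in the usual order) with $\ell_g(n)=h$. *)

theory Defs
  imports Complex_Main "Graph_Theory.Graph_Theory"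
begin

text \<open>
  The group is written additively. The Cayley graph is undirected, so each of its edges is
  represented by both of the corresponding arcs.
\<close>

definition cayley_graph :: "'a::group_add set \<Rightarrow> 'a pair_pre_digraph" where
  "cayley_graph S =
     \<lparr> pverts = UNIV, parcs = {(x, y). \<exists>s\<in>S. x + s = y \<or> y + s = x} \<rparr>"

lemma wf_digraph_cayley_graph: "wf_digraph (with_proj (cayley_graph S))"
  by (simp add: wf_digraph_def cayley_graph_def)

text \<open>The value is \<^term>\<open>\<infinity> :: ereal\<close> if the two vertices are not connected.\<close>

definition cayley_dist :: "'a::group_add set \<Rightarrow> 'a \<Rightarrow> 'a \<Rightarrow> ereal" where
  "cayley_dist S x y = wf_digraph.\<mu> (with_proj (cayley_graph S)) (\<lambda>_. 1) x y"

definition power_gens :: "int \<Rightarrow> int set" where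
  "power_gens g = {s. \<exists>i::nat. s = g ^ i \<or> s = - (g ^ i)}"

definition g_length :: "int \<Rightarrow> int \<Rightarrow> ereal" where
  "g_length g n = cayley_dist (power_gens g) 0 n"

definition smallest_of_length :: "int \<Rightarrow> int \<Rightarrow> int" where
  "smallest_of_length g h = (LEAST n. 0 < n \<and> g_length g n = ereal (of_int h))"

end

theory Submission
  imports Defs
begin

text \<open>
  Write \<open>g = 2 h\<close>. In a shortest expression of \<open>n\<close> the summands \<open>\<plusminus>1\<close> add up to a number \<open>e\<close> that
  is congruent to \<open>n\<close> modulo \<open>g\<close>, and the other summands form an expression of \<open>n - e\<close> that can be
  divided by \<open>g\<close>. As \<open>g\<close> equal units can be exchanged for one summand \<open>\<plusminus>g\<close>, only values of \<open>e\<close>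
  strictly between \<open>-g\<close> and \<open>g\<close> matter, of which there are at most two, so the length
  obeys a recursion on base-\<open>g\<close> digits:
  \<open>len (g m + d) = min (d + len m) (g - d + len (m + 1))\<close> for \<open>0 \<le> d \<le> g\<close>.

  The only expensive digit is \<open>h\<close>: any other residue is reached with at most \<open>h - 1\<close> units. Let
  \<open>L\<close> be the first number of length \<open>k\<close>. Then \<open>L - 1\<close> has length \<open>k - 1\<close>, and appending two
  digits \<open>h\<close> to it costs the full \<open>2 h = g\<close>, since rounding the upper digit up replaces \<open>L - 1\<close>
  by the longer \<open>L\<close>, and rounding the lower one up saves nothing either. For a number
  below that, two digits on a prefix of length at most \<open>k - 1\<close> never cost that much: even if both
  last digits are \<open>h\<close>, the prefix is then below \<open>L - 1\<close>, and rounding the lower digit up turns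
  the upper one into \<open>h + 1\<close>, which can be rounded up at the price of only \<open>h - 1\<close> units, and the
  new prefix still has length at most \<open>k - 1\<close>. So the first number of length \<open>k + (g - 1)\<close>
  arises by appending two digits \<open>h\<close> to \<open>L - 1\<close>, that is, it equals \<open>g (g (L - 1) + h) + h\<close>
  (\<open>first_of_length_step\<close>). For \<open>1 \<le> k \<le> g - 1\<close> the first number of length \<open>k\<close> is found
  directly: it is \<open>k\<close> if \<open>k \<le> h\<close>, and \<open>h + (k - h) g\<close> otherwise. The formula is the solution of this
  linear recurrence with these initial values.
\<close>

section \<open>Distance in a Cayley graph as a number of summands\<close>

definition sum_length :: "'a::monoid_add set \<Rightarrow> 'a \<Rightarrow> nat" where
  "sum_length S x = (LEAST j. \<exists>xs. set xs \<subseteq> S \<and> length xs = j \<and> sum_list xs = x)"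

lemma sum_length_le:
  assumes "set xs \<subseteq> S" "sum_list xs = x"
  shows "sum_length S x \<le> length xs"
  unfolding sum_length_def using assms by (intro Least_le) blast

lemma sum_length_attained:
  assumes "set xs \<subseteq> S" "sum_list xs = x"
  obtains ys where "set ys \<subseteq> S" "sum_list ys = x" "length ys = sum_length S x"
proof -
  have "\<exists>ys. set ys \<subseteq> S \<and> length ys = sum_length S x \<and> sum_list ys = x"
    unfolding sum_length_def
    by (rule LeastI_ex) (use assms in blast)
  then show ?thesis using that by blast
qed

text \<open>
  Symmetry of the generating set makes every arc a right translation by a generator, so the steps of
  a walk, in order, are the summands.
\<close>

lemma walk_iff_sum_list:
  fixes S :: "'a::group_add set"
  assumes sym: "\<And>s. s \<in> S \<Longrightarrow> - s \<in> S"
  shows "(\<exists>p. pre_digraph.awalk (with_proj (cayley_graph S)) x p y \<and> length p = j)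
     \<longleftrightarrow> (\<exists>xs. set xs \<subseteq> S \<and> length xs = j \<and> x + sum_list xs = y)"
proof -
  interpret G: wf_digraph "with_proj (cayley_graph S)" by (rule wf_digraph_cayley_graph)
  have arc: "(u, v) \<in> parcs (cayley_graph S) \<longleftrightarrow> - u + v \<in> S" for u v :: 'a
  proof
    assume "(u, v) \<in> parcs (cayley_graph S)"
    then obtain s where s: "s \<in> S" "u + s = v \<or> v + s = u"
      by (auto simp: cayley_graph_def)
    from s(2) have "- u + v = s \<or> - u + v = - s"
      by (auto simp: minus_add add.assoc)
    with s(1) sym show "- u + v \<in> S" by auto
  next
    assume "- u + v \<in> S"
    then show "(u, v) \<in> parcs (cayley_graph S)"
      by (auto simp: cayley_graph_def add.assoc[symmetric] intro!: bexI[of _ "- u + v"])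
  qed
  show ?thesis
  proof (induction j arbitrary: x)
    case 0
    have "x \<in> pverts (cayley_graph S)" by (simp add: cayley_graph_def)
    then show ?case by (auto simp: G.awalk_Nil_iff)
  next
    case (Suc j)
    have "(\<exists>p. G.awalk x p y \<and> length p = Suc j)
        \<longleftrightarrow> (\<exists>z. - x + z \<in> S \<and> (\<exists>p. G.awalk z p y \<and> length p = j))"
    proof (intro iffI; elim exE conjE)
      fix p assume p: "G.awalk x p y" "length p = Suc j"
      then obtain u z p' where [simp]: "p = (u, z) # p'" by (cases p) auto
      show "\<exists>z. - x + z \<in> S \<and> (\<exists>p. G.awalk z p y \<and> length p = j)"
        using p by (intro exI[of _ z] conjI exI[of _ p']) (auto simp: G.awalk_Cons_iff arc)
    next
      fix z p assume "- x + z \<in> S" "G.awalk z p y" "length p = j"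
      then show "\<exists>p. G.awalk x p y \<and> length p = Suc j"
        by (intro exI[of _ "(x, z) # p"]) (auto simp: G.awalk_Cons_iff arc)
    qed
    also have "\<dots> \<longleftrightarrow> (\<exists>z. - x + z \<in> S \<and> (\<exists>xs. set xs \<subseteq> S \<and> length xs = j \<and> z + sum_list xs = y))"
      using Suc.IH by simp
    also have "\<dots> \<longleftrightarrow> (\<exists>xs. set xs \<subseteq> S \<and> length xs = Suc j \<and> x + sum_list xs = y)"
    proof (intro iffI; elim exE conjE)
      fix z xs assume "- x + z \<in> S" "set xs \<subseteq> S" "length xs = j" "z + sum_list xs = y"
      then show "\<exists>xs. set xs \<subseteq> S \<and> length xs = Suc j \<and> x + sum_list xs = y"
        by (intro exI[of _ "(- x + z) # xs"]) (auto simp: add.assoc[symmetric])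
    next
      fix xs assume xs: "set xs \<subseteq> S" "length xs = Suc j" "x + sum_list xs = y"
      then obtain s ys where [simp]: "xs = s # ys" by (cases xs) auto
      show "\<exists>z. - x + z \<in> S \<and> (\<exists>xs. set xs \<subseteq> S \<and> length xs = j \<and> z + sum_list xs = y)"
        using xs by (intro exI[of _ "x + s"] conjI exI[of _ ys]) (auto simp: add.assoc[symmetric])
    qed
    finally show ?case .
  qed
qed

lemma cayley_dist_eq_sum_length:
  fixes S :: "'a::group_add set"
  assumes sym: "\<And>s. s \<in> S \<Longrightarrow> - s \<in> S" and xs: "set xs \<subseteq> S" "sum_list xs = x"
  shows "cayley_dist S 0 x = ereal (sum_length S x)"
proof -
  interpret G: wf_digraph "with_proj (cayley_graph S)" by (rule wf_digraph_cayley_graph)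
  have cost: "G.awalk_cost (\<lambda>_. 1) p = length p" for p
    by (induction p) auto
  obtain ys where "set ys \<subseteq> S" "sum_list ys = x" "length ys = sum_length S x"
    using sum_length_attained[OF xs] .
  then obtain p where p: "G.awalk 0 p x" "length p = sum_length S x"
    using walk_iff_sum_list[OF sym, where x = 0 and y = x and j = "sum_length S x"] by auto
  have "sum_length S x \<le> length p'" if "G.awalk 0 p' x" for p'
    using that walk_iff_sum_list[OF sym, where x = 0 and y = x and j = "length p'"]
    by (metis add_0 sum_length_le)
  then show ?thesis
    unfolding cayley_dist_def G.\<mu>_def cost
    by (intro antisym INF_greatest INF_lower2[of p]) (use p in auto)
qed

section \<open>The length function and its recursion on digits\<close>

text \<open>Integer-valued, so that lengths and digits can be subtracted without truncation.\<close>

definition len :: "int \<Rightarrow> int \<Rightarrow> int" where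
  "len g n = int (sum_length (power_gens g) n)"

lemma uminus_power_gens: "s \<in> power_gens g \<Longrightarrow> - s \<in> power_gens g"
  by (auto simp: power_gens_def)

lemma sum_of_units: "\<exists>xs. set xs \<subseteq> power_gens g \<and> sum_list xs = n \<and> int (length xs) = \<bar>n\<bar>"
proof -
  have one: "1 \<in> power_gens g" "-1 \<in> power_gens g"
    by (auto simp: power_gens_def intro!: exI[of _ 0])
  show ?thesis
    using one
    by (intro exI[of _ "replicate (nat \<bar>n\<bar>) (sgn n)"])
       (auto simp: sum_list_replicate sgn_if split: if_splits)
qed

lemma len_attained:
  obtains xs where "set xs \<subseteq> power_gens g" "sum_list xs = n" "int (length xs) = len g n"
  by (metis len_def sum_of_units sum_length_attained)

lemma len_le: "set xs \<subseteq> power_gens g \<Longrightarrow> sum_list xs = n \<Longrightarrow> len g n \<le> int (length xs)"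
  by (simp add: len_def sum_length_le)

lemma g_length_eq_len: "g_length g n = ereal (of_int (len g n))"
proof -
  obtain xs where "set xs \<subseteq> power_gens g" "sum_list xs = n" using len_attained .
  then show ?thesis
    unfolding g_length_def len_def
    using cayley_dist_eq_sum_length[of "power_gens g", OF uminus_power_gens] by simp
qed

lemma len_nonneg: "0 \<le> len g n"
  by (simp add: len_def)

lemma len_0 [simp]: "len g 0 = 0"
  using len_le[of "[]" g 0] len_nonneg[of g 0] by simp

lemma len_pos: "n \<noteq> 0 \<Longrightarrow> 0 < len g n"
  by (rule len_attained[of g n]) (cases "len g n = 0"; use len_nonneg[of g n] in auto)

lemma len_le_abs: "len g n \<le> \<bar>n\<bar>"
  using sum_of_units[of g n] len_le[of _ g n] by force

lemma len_add_le: "len g (a + b) \<le> len g a + len g b"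
proof -
  obtain xs where "set xs \<subseteq> power_gens g" "sum_list xs = a" "int (length xs) = len g a"
    using len_attained .
  moreover obtain ys where "set ys \<subseteq> power_gens g" "sum_list ys = b" "int (length ys) = len g b"
    using len_attained .
  ultimately show ?thesis using len_le[of "xs @ ys" g "a + b"] by simp
qed

lemma len_le_add_dist: "len g a \<le> len g b + \<bar>a - b\<bar>"
  using len_add_le[of g b "a - b"] len_le_abs[of g "a - b"] by simp

lemma len_power_gen_le:
  assumes "s \<in> power_gens g"
  shows "len g s \<le> 1"
  using len_le[of "[s]" g s] assms by simp

lemma len_mult_base_le: "len g (g * m) \<le> len g m"
proof -
  obtain xs where xs: "set xs \<subseteq> power_gens g" "sum_list xs = m" "int (length xs) = len g m"
    using len_attained .
  have "g * s \<in> power_gens g" if "s \<in> power_gens g" for s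
  proof -
    from that obtain i where "s = g ^ i \<or> s = - (g ^ i)" by (auto simp: power_gens_def)
    then have "g * s = g ^ Suc i \<or> g * s = - (g ^ Suc i)" by auto
    then show ?thesis unfolding power_gens_def by blast
  qed
  then have "set (map ((*) g) xs) \<subseteq> power_gens g" using xs(1) by auto
  then show ?thesis using xs len_le[of "map ((*) g) xs" g "g * m"] by (simp add: sum_list_const_mult)
qed

lemma len_mult_base_add_le: "len g (g * m + e) \<le> \<bar>e\<bar> + len g m"
  using len_add_le[of g "g * m" e] len_mult_base_le[of g m] len_le_abs[of g e] by simp

text \<open>Collecting the units of an expression in \<open>e\<close> leaves summands that are divisible by \<open>g\<close>.\<close>

lemma split_off_units:
  assumes "set xs \<subseteq> power_gens g"
  shows "\<exists>e m. sum_list xs = g * m + e \<and> \<bar>e\<bar> + len g m \<le> int (length xs)"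
  using assms
proof (induction xs)
  case Nil
  show ?case by (intro exI[of _ 0]) simp
next
  case (Cons s xs)
  then obtain e m where em: "sum_list xs = g * m + e" "\<bar>e\<bar> + len g m \<le> int (length xs)"
    by auto
  from Cons.prems have "s \<in> power_gens g" by simp
  then obtain i where i: "s = g ^ i \<or> s = - (g ^ i)" by (auto simp: power_gens_def)
  show ?case
  proof (cases i)
    case 0
    with i em show ?thesis by (intro exI[of _ "e + s"] exI[of _ m]) auto
  next
    case (Suc l)
    then obtain t where t: "s = g * t" "t \<in> power_gens g"
      using i unfolding power_gens_def
      by (metis (mono_tags, lifting) mem_Collect_eq mult_minus_right power_Suc)
    have "len g (m + t) \<le> len g m + 1"
      using len_add_le[of g m t] len_power_gen_le[OF t(2)] by simp
    with em t(1) show ?thesis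
      by (intro exI[of _ e] exI[of _ "m + t"]) (auto simp: algebra_simps)
  qed
qed

text \<open>
  Any number of units that is congruent to \<open>d\<close> can be moved towards \<open>0\<close>, to \<open>d\<close> or to \<open>d - g\<close>, at no
  loss: a move by \<open>g t\<close> saves at least \<open>\<bar>t\<bar>\<close> units and changes the quotient by \<open>t\<close>, hence its
  length by at most \<open>\<bar>t\<bar>\<close>.
\<close>

lemma len_digit_recursion:
  assumes g: "1 < g" and d: "0 \<le> d" "d \<le> g"
  shows "len g (g * m + d) = min (d + len g m) (g - d + len g (m + 1))"
proof (rule antisym)
  have up: "g * (m + 1) + (d - g) = g * m + d" by (simp add: algebra_simps)
  show "len g (g * m + d) \<le> min (d + len g m) (g - d + len g (m + 1))"
    using len_mult_base_add_le[of g m d] len_mult_base_add_le[of g "m + 1" "d - g", unfolded up] d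
    by simp
next
  obtain xs where xs: "set xs \<subseteq> power_gens g" "sum_list xs = g * m + d"
    "int (length xs) = len g (g * m + d)"
    using len_attained .
  obtain e m' where e: "g * m + d = g * m' + e" "\<bar>e\<bar> + len g m' \<le> len g (g * m + d)"
    using split_off_units[OF xs(1)] xs by auto
  define t where "t = m - m'"
  have et: "e = d + g * t" using e(1) by (simp add: t_def algebra_simps)
  show "min (d + len g m) (g - d + len g (m + 1)) \<le> len g (g * m + d)"
  proof (cases "0 \<le> t")
    case True
    then have "t \<le> g * t" using g by (simp add: mult_le_cancel_right1)
    then show ?thesis
      using len_le_add_dist[of g m m'] e(2) et d True by (simp add: t_def[symmetric])
  next
    case False
    then have "- t - 1 \<le> g * (- t - 1)" using g by (simp only: mult_le_cancel_right1) simp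
    then have "(g - d) + (- t - 1) \<le> - e" using et by (simp add: algebra_simps)
    moreover have "len g (m + 1) \<le> len g m' + (- t - 1)"
      using len_le_add_dist[of g "m + 1" m'] False by (simp add: t_def)
    ultimately show ?thesis using e(2) by linarith
  qed
qed

section \<open>The first number of a given length\<close>

definition first_of_length :: "int \<Rightarrow> int \<Rightarrow> int \<Rightarrow> bool" where
  "first_of_length g k L \<longleftrightarrow> 0 < L \<and> len g L = k \<and> (\<forall>n. 0 \<le> n \<and> n < L \<longrightarrow> len g n < k)"

lemma smallest_of_length_eqI:
  assumes "first_of_length g k L"
  shows "smallest_of_length g k = L"
  unfolding smallest_of_length_def g_length_eq_len
proof (rule Least_equality)
  show "0 < L \<and> ereal (of_int (len g L)) = ereal (of_int k)"
    using assms by (simp add: first_of_length_def)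
next
  fix n :: int
  assume "0 < n \<and> ereal (of_int (len g n)) = ereal (of_int k)"
  then have "0 \<le> n" "\<not> len g n < k" by auto
  then show "L \<le> n" using assms unfolding first_of_length_def by (meson not_less)
qed

locale even_base =
  fixes g h :: int
  assumes base_eq: "g = 2 * h" and half_pos: "1 \<le> h"
begin

lemma base_gt_1: "1 < g"
  using base_eq half_pos by simp

lemma len_half_digit: "len g (g * m + h) = h + min (len g m) (len g (m + 1))"
  using len_digit_recursion[OF base_gt_1, of h m] base_eq half_pos by simp

text \<open>
  A residue other than \<open>h\<close> has a representative of absolute value at most \<open>h - 1\<close>. The bound
  \<open>g U + h\<close> is the largest for which rounding to this representative never yields a quotient
  greater than \<open>U\<close>.
\<close>

lemma len_le_if_not_half_digit:
  assumes U: "\<And>u. 0 \<le> u \<Longrightarrow> u \<le> U \<Longrightarrow> len g u \<le> c"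
    and n: "0 \<le> n" "n \<le> g * U + h" "n mod g \<noteq> h"
  shows "len g n \<le> h - 1 + c"
proof -
  define m where "m = n div g"
  define d where "d = n mod g"
  have nmd: "n = g * m + d" by (simp add: m_def d_def)
  have d: "0 \<le> d" "d < g" "d \<noteq> h" using base_gt_1 n(3) by (auto simp: d_def)
  have m: "0 \<le> m" using n(1) base_gt_1 by (simp add: m_def pos_imp_zdiv_nonneg_iff)
  show ?thesis
  proof (cases "d < h")
    case True
    have "g * m < g * (U + 1)" using n(2) nmd d base_eq half_pos by (simp add: algebra_simps)
    then have "m \<le> U" using base_gt_1 by simp
    then show ?thesis
      using U[of m] m len_mult_base_add_le[of g m d] d True nmd by simp
  next
    case False
    have "g * m < g * U" using n(2) nmd d False by linarith
    then have "m + 1 \<le> U" using base_gt_1 by simp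
    moreover have "n = g * (m + 1) + (d - g)" using nmd by (simp add: algebra_simps)
    ultimately show ?thesis
      using U[of "m + 1"] m len_mult_base_add_le[of g "m + 1" "d - g"] d False base_eq by simp
  qed
qed

lemma half_digit_cases:
  assumes n: "0 \<le> n" "n mod g = h"
  obtains m where "n = g * m + h" "0 \<le> m"
proof
  show "n = g * (n div g) + h" using n(2) by (metis mult_div_mod_eq)
  show "0 \<le> n div g" using n(1) base_gt_1 by (simp add: pos_imp_zdiv_nonneg_iff)
qed

lemma len_le_append_digit:
  assumes U: "\<And>u. 0 \<le> u \<Longrightarrow> u \<le> U \<Longrightarrow> len g u \<le> c"
    and n: "0 \<le> n" "n \<le> g * U + h"
  shows "len g n \<le> h + c"
proof (cases "n mod g = h")
  case True
  then obtain m where m: "n = g * m + h" "0 \<le> m" using half_digit_cases n(1) by blast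
  then have "m \<le> U" using n(2) base_gt_1 by simp
  then show ?thesis using U[of m] m len_half_digit[of m] by simp
next
  case False
  then show ?thesis using len_le_if_not_half_digit[OF U n] by simp
qed

text \<open>
  The digits \<open>h h\<close> after \<open>L - 1\<close>, a number of length \<open>k - 1\<close>, cost \<open>g\<close> because rounding up one
  or both of them gains nothing. A smaller number needs care only if its last digit is \<open>h\<close>; if the
  digit before it is \<open>h\<close> as well, rounding up the last digit makes that one cheap, and the
  number before the last digit stays at most \<open>g (L - 1) + h\<close>, so that its own prefix can be kept
  below \<open>L\<close>.
\<close>

lemma first_of_length_step:
  assumes L: "first_of_length g k L"
  shows "first_of_length g (k + (g - 1)) (g * (g * (L - 1) + h) + h)"
proof -
  define M where "M = g * (L - 1) + h"
  have Lpos: "0 < L" and lenL: "len g L = k" and below: "\<And>n. 0 \<le> n \<Longrightarrow> n < L \<Longrightarrow> len g n < k"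
    using L by (auto simp: first_of_length_def)
  have len_pred: "len g (L - 1) = k - 1"
    using below[of "L - 1"] Lpos len_le_add_dist[of g L "L - 1"] lenL by simp
  have "len g M = h + k - 1"
    using len_half_digit[of "L - 1"] len_pred lenL by (simp add: M_def)
  moreover have "len g (M + 1) = h + k - 1"
    using len_digit_recursion[OF base_gt_1, of "h + 1" "L - 1"] base_eq half_pos len_pred lenL
    by (simp add: M_def add.assoc)
  ultimately have len_N: "len g (g * M + h) = k + (g - 1)"
    using len_half_digit[of M] base_eq by simp
  have U: "len g u \<le> k - 1" if "0 \<le> u" "u \<le> L - 1" for u
    using below[of u] that by simp
  have uptoM: "len g u \<le> h + (k - 1)" if "0 \<le> u" "u \<le> M" for u
    using len_le_append_digit[of "L - 1" "k - 1" u] U that by (simp add: M_def)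
  have lt: "len g n < k + (g - 1)" if n: "0 \<le> n" "n < g * M + h" for n
  proof (cases "n mod g = h")
    case False
    have "len g n \<le> h - 1 + (h + (k - 1))"
      using len_le_if_not_half_digit[of M "h + (k - 1)" n] uptoM n False by simp
    then show ?thesis using base_eq by simp
  next
    case True
    then obtain m where m: "n = g * m + h" "0 \<le> m" using half_digit_cases n(1) by blast
    then have mM: "m < M" using n(2) base_gt_1 by simp
    have "min (len g m) (len g (m + 1)) \<le> h - 1 + (k - 1)"
    proof (cases "m mod g = h")
      case False
      then show ?thesis
        using len_le_if_not_half_digit[of "L - 1" "k - 1" m] U m mM by (simp add: M_def)
    next
      case True
      have "(m + 1) mod g \<noteq> h"
      proof
        assume "(m + 1) mod g = h"
        then have "g dvd (m + 1) - m" using True by (metis mod_eq_dvd_iff)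
        then show False using base_gt_1 by simp
      qed
      then show ?thesis
        using len_le_if_not_half_digit[of "L - 1" "k - 1" "m + 1"] U m mM by (simp add: M_def)
    qed
    then show ?thesis using m len_half_digit[of m] base_eq by simp
  qed
  have "0 \<le> g * (L - 1)" using Lpos base_gt_1 by simp
  then have "0 < M" using half_pos by (simp add: M_def)
  then have "0 < g * M + h" using base_gt_1 half_pos by (simp add: add_pos_pos)
  with len_N lt show ?thesis by (simp add: first_of_length_def M_def)
qed

lemma len_small:
  assumes "0 \<le> s" "s \<le> h"
  shows "len g s = s"
  using len_digit_recursion[OF base_gt_1, of s 0] len_pos[of 1 g] base_eq assms by simp

lemma first_of_length_small:
  assumes "1 \<le> s" "s \<le> h"
  shows "first_of_length g s s"
  using assms by (auto simp: first_of_length_def len_small)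

text \<open>
  Here rounding up \<open>h\<close> gains nothing because \<open>j + 1 \<le> h\<close>, so the quotient would become longer.
\<close>

lemma first_of_length_two_digits:
  assumes "0 < j" "j < h"
  shows "first_of_length g (h + j) (h + j * g)"
proof -
  have "len g (g * j + h) = h + j"
    using len_half_digit[of j] len_small[of j] len_small[of "j + 1"] assms by simp
  moreover have "len g n < h + j" if n: "0 \<le> n" "n < g * j + h" for n
  proof (cases "n mod g = h")
    case True
    then obtain m where m: "n = g * m + h" "0 \<le> m" using half_digit_cases n(1) by blast
    then have "m < j" using n(2) base_gt_1 by simp
    then show ?thesis using m len_half_digit[of m] len_le_abs[of g m] by simp
  next
    case False
    have "len g u \<le> j" if "0 \<le> u" "u \<le> j" for u
      using that len_le_abs[of g u] by simp
    then show ?thesis using len_le_if_not_half_digit[of j j n] n False by simp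
  qed
  moreover have "0 < g * j + h" using assms base_gt_1 by (simp add: add_pos_pos)
  ultimately show ?thesis by (simp add: first_of_length_def algebra_simps)
qed

lemma first_of_length_below_base:
  assumes "1 \<le> s" "s \<le> g - 1"
  shows "first_of_length g s (min s h + max 0 (s - h) * g)"
proof (cases "s \<le> h")
  case True
  then show ?thesis using first_of_length_small assms by simp
next
  case False
  then show ?thesis using first_of_length_two_digits[of "s - h"] assms base_eq by simp
qed

lemma first_of_length_closed_form:
  assumes b: "first_of_length g s b"
  shows "\<exists>L. first_of_length g (s + int Q * (g - 1)) L \<and>
    real_of_int L = g * (1 - real_of_int g ^ (2 * Q)) / (2 * (1 + g)) + b * real_of_int g ^ (2 * Q)"
proof (induction Q)
  case 0
  show ?case using b by auto
next
  case (Suc Q)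
  then obtain L where L: "first_of_length g (s + int Q * (g - 1)) L"
    and eq: "real_of_int L =
      g * (1 - real_of_int g ^ (2 * Q)) / (2 * (1 + g)) + b * real_of_int g ^ (2 * Q)"
    by blast
  have "real_of_int (g * (g * (L - 1) + h) + h) = real_of_int g ^ 2 * L - g * (g - 1) / 2"
    using base_eq by (simp add: field_simps power2_eq_square)
  also have "\<dots> = g * (1 - real_of_int g ^ (2 * Suc Q)) / (2 * (1 + g))
      + b * real_of_int g ^ (2 * Suc Q)"
    using base_gt_1 unfolding eq by (simp add: field_simps power2_eq_square)
  finally show ?case
    using first_of_length_step[OF L] by (auto simp: algebra_simps intro!: exI)
qed

end

section \<open>The formula\<close>

theorem theorem3p7:
  fixes g k r q A B :: int
  assumes "g > 1" and "even g" and "k > 0"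
    and "r = k mod (g - 1)"
    and "q = (if r = 0 then \<lfloor>real_of_int k / real_of_int (g - 1)\<rfloor> - 1
              else \<lfloor>real_of_int k / real_of_int (g - 1)\<rfloor>)"
    and "A = (if r = 0 \<or> r > g div 2 then g div 2 else r)"
    and "B = (if r = 0 then g div 2 - 1 else if r > g div 2 then r - g div 2 else 0)"
  shows "real_of_int (smallest_of_length g k) =
           real_of_int g * (1 - real_of_int g powi (2 * q)) / (2 * (1 + real_of_int g))
           + real_of_int A * real_of_int g powi (2 * q)
           + real_of_int B * real_of_int g powi (2 * q + 1)"
proof -
  define h where "h = g div 2"
  interpret even_base g h
    using assms(1,2) by unfold_locales (auto simp: h_def)
  \<comment> \<open>The remainder of \<open>k\<close> modulo \<open>g - 1\<close>, chosen between \<open>1\<close> and \<open>g - 1\<close>.\<close>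
  define s where "s = (if r = 0 then g - 1 else r)"
  have floor: "\<lfloor>real_of_int k / real_of_int (g - 1)\<rfloor> = k div (g - 1)"
    by (rule floor_divide_of_int_eq)
  have k: "k = (k div (g - 1)) * (g - 1) + r" unfolding assms(4) by (rule div_mult_mod_eq[symmetric])
  have r: "0 \<le> r" "r < g - 1" using assms(1,4) by auto
  have s: "1 \<le> s" "s \<le> g - 1" using r assms(1) by (auto simp: s_def)
  have ks: "k = s + q * (g - 1)"
    using k floor assms(5) by (auto simp: s_def algebra_simps)
  have "0 \<le> q"
  proof (rule ccontr)
    assume "\<not> 0 \<le> q"
    then have "q * (g - 1) \<le> (- 1) * (g - 1)" using assms(1) by (intro mult_right_mono) auto
    with ks s assms(3) show False by simp
  qed
  then obtain Q where Q: "q = int Q" using zero_le_imp_eq_int by blast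
  have AB: "min s h + max 0 (s - h) * g = A + B * g"
    using assms(6,7) base_eq half_pos r by (auto simp: s_def h_def[symmetric])
  obtain L where L: "first_of_length g k L"
    and eq: "real_of_int L = g * (1 - real_of_int g ^ (2 * Q)) / (2 * (1 + g))
      + real_of_int (A + B * g) * real_of_int g ^ (2 * Q)"
    using first_of_length_closed_form[OF first_of_length_below_base[OF s], of Q] ks Q AB by auto
  have powi: "real_of_int g powi (2 * q) = real_of_int g ^ (2 * Q)"
    "real_of_int g powi (2 * q + 1) = real_of_int g * real_of_int g ^ (2 * Q)"
  proof -
    have "2 * q = int (2 * Q)" "2 * q + 1 = int (Suc (2 * Q))" using Q by simp_all
    then show "real_of_int g powi (2 * q) = real_of_int g ^ (2 * Q)"
      "real_of_int g powi (2 * q + 1) = real_of_int g * real_of_int g ^ (2 * Q)"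
      by (simp_all only: power_int_of_nat power_Suc)
  qed
  show ?thesis
    unfolding smallest_of_length_eqI[OF L] eq powi by (simp add: algebra_simps)
qed

end
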